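(* For all integers $n\ge0$, \[ E_n(-1/q,q) = \frac{1}{(1-q)^{2n}} \sum_{k=0}^n \left( \binom{2n}{n-k} - \binom{2n}{n-k-1} \right) \sum_{i=-k}^k (-q)^{i^2}. \]
   Context: Here $[n]_q=(1-q^n)/(1-q)$ and $[n]_{t,q}=(1-tq^n)/(1-q)$. The $(t,q)$-Euler numbers $E_n(t,q)$, $n\ge 0$, are defined by the continued fraction expansion (as a formal power series in $x$) \[ \sum_{n\geq0} E_{n}(t,q) x^n = \cfrac{1}{1- \cfrac{[1]_q[1]_{t,q}\, x}{1- \cfrac{[2]_q[2]_{t,q}\, x}{1-\cdots}}}, \] where the $m$-th partial coefficient is $[m]_q[m]_{t,q}$. $E_n(-1/q,q)$ is the value at $t=-1/q$. Binomial coefficients $\binom{a}{b}$ with $b<0$ are $0$. *)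

theory Defs
  imports "HOL-Computational_Algebra.Computational_Algebra"
begin

definition q_bracket :: "'a::field \<Rightarrow> nat \<Rightarrow> 'a" where
  "q_bracket q n = (1 - q ^ n) / (1 - q)"

definition tq_bracket :: "'a::field \<Rightarrow> 'a \<Rightarrow> nat \<Rightarrow> 'a" where
  "tq_bracket t q n = (1 - t * q ^ n) / (1 - q)"

(* cf_denom c m N is the denominator
     1 - c m * X / (1 - c (m+1) * X / ( ... / (1 - c (m+N-1) * X)))
   with N partial coefficients, starting at index m. *)
primrec cf_denom :: "(nat \<Rightarrow> 'a::field) \<Rightarrow> nat \<Rightarrow> nat \<Rightarrow> 'a fps" where
  "cf_denom c m 0 = 1"
| "cf_denom c m (Suc N) = 1 - fps_const (c m) * fps_X / cf_denom c (Suc m) N"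

(* The limit is in the X-adic metric on formal power series; it exists for every c,
   see cf_convergents_LIMSEQ. *)
definition continued_fraction_fps :: "(nat \<Rightarrow> 'a::field) \<Rightarrow> 'a fps" where
  "continued_fraction_fps c = lim (\<lambda>N. 1 / cf_denom c 1 N)"

(* t and q are elements of an arbitrary field; taking a rational function field gives
   the generic case of indeterminates. *)
definition tq_Euler :: "nat \<Rightarrow> 'a::field \<Rightarrow> 'a \<Rightarrow> 'a" where
  "tq_Euler n t q =
     fps_nth (continued_fraction_fps (\<lambda>m. q_bracket q m * tq_bracket t q m)) n"

definition binom :: "nat \<Rightarrow> int \<Rightarrow> nat" where
  "binom a b = (if b < 0 then 0 else a choose nat b)"

lemma cf_denom_nth_0 [simp]: "fps_nth (cf_denom c m N) 0 = 1"
  by (induction N arbitrary: m) (simp_all add: fps_divide_unit)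

lemma fps_inverse_diff_dvd:
  fixes a b :: "'a::field fps"
  assumes "fps_nth a 0 \<noteq> 0" "fps_nth b 0 \<noteq> 0" "d dvd a - b"
  shows "d dvd inverse a - inverse b"
proof -
  have "a * inverse a = 1" "b * inverse b = 1"
    using assms by (simp_all add: inverse_mult_eq_1')
  then have "inverse a - inverse b = - ((a - b) * (inverse a * inverse b))"
    by (simp add: algebra_simps)
  then show ?thesis
    using assms(3) by simp
qed

lemma cf_denom_diff_dvd:
  "N \<le> M \<Longrightarrow> fps_X ^ Suc N dvd cf_denom c m M - cf_denom c m N"
proof (induction N arbitrary: m M)
  case 0
  show ?case
    by (cases M) (simp_all add: fps_divide_unit mult.assoc)
next
  case (Suc N)
  then obtain M' where M: "M = Suc M'" and le: "N \<le> M'"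
    by (cases M) auto
  have "fps_X ^ Suc N dvd inverse (cf_denom c (Suc m) M') - inverse (cf_denom c (Suc m) N)"
    by (rule fps_inverse_diff_dvd) (use Suc.IH[OF le] in auto)
  then have "fps_X * fps_X ^ Suc N dvd
      fps_X * (inverse (cf_denom c (Suc m) M') - inverse (cf_denom c (Suc m) N))"
    by (rule mult_dvd_mono[OF dvd_refl])
  then have "fps_X ^ Suc (Suc N) dvd
      - fps_const (c m) * (fps_X * (inverse (cf_denom c (Suc m) M') - inverse (cf_denom c (Suc m) N)))"
    by (simp add: dvd_mult)
  also have "\<dots> = cf_denom c m M - cf_denom c m (Suc N)"
    by (simp add: M fps_divide_unit algebra_simps flip: fps_const_neg)
  finally show ?case .
qed

lemma cf_convergent_nth:
  assumes "n \<le> N"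
  shows "fps_nth (1 / cf_denom c m N) n = fps_nth (1 / cf_denom c m n) n"
proof -
  have "fps_X ^ Suc n dvd inverse (cf_denom c m N) - inverse (cf_denom c m n)"
    by (rule fps_inverse_diff_dvd) (use cf_denom_diff_dvd[OF assms] in auto)
  then obtain g where "inverse (cf_denom c m N) - inverse (cf_denom c m n) = fps_X ^ Suc n * g" ..
  then have "fps_nth (inverse (cf_denom c m N) - inverse (cf_denom c m n)) n = 0"
    by (simp only: fps_X_power_mult_nth) simp
  then show ?thesis
    by (simp add: fps_divide_unit)
qed

lemma cf_convergents_LIMSEQ:
  "(\<lambda>N. 1 / cf_denom c 1 N) \<longlonglongrightarrow> continued_fraction_fps c"
proof -
  have "(\<lambda>N. 1 / cf_denom c 1 N) \<longlonglongrightarrow> Abs_fps (\<lambda>n. fps_nth (1 / cf_denom c 1 n) n)"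
  proof (rule tendsto_fpsI)
    fix n
    show "\<forall>\<^sub>F N in sequentially. fps_nth (1 / cf_denom c 1 N) n =
        fps_nth (Abs_fps (\<lambda>n. fps_nth (1 / cf_denom c 1 n) n)) n"
      using eventually_ge_at_top[of n]
      by eventually_elim (simp only: fps_nth_Abs_fps, rule cf_convergent_nth)
  qed
  then show ?thesis
    unfolding continued_fraction_fps_def by (simp add: limI)
qed

lemma continued_fraction_fps_nth:
  assumes "n \<le> N"
  shows "fps_nth (continued_fraction_fps c) n = fps_nth (1 / cf_denom c 1 N) n"
proof -
  have "\<forall>\<^sub>F M in sequentially. fps_nth (1 / cf_denom c 1 M) n = fps_nth (continued_fraction_fps c) n"
    using cf_convergents_LIMSEQ[of c] unfolding tendsto_fps_iff by blast
  then obtain M where "M \<ge> n" "fps_nth (1 / cf_denom c 1 M) n = fps_nth (continued_fraction_fps c) n"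
    unfolding eventually_sequentially by (meson linorder_linear)
  then show ?thesis
    using cf_convergent_nth[of n M c 1] cf_convergent_nth[OF assms, of c 1] by simp
qed

end

theory Submission
  imports Defs
begin

text \<open>
  Write \<open>c\<^sub>m\<close> for the partial coefficients. If power series \<open>R\<^sub>0 = 1, R\<^sub>1, R\<^sub>2, \<dots>\<close> with constant
  term \<open>1\<close> satisfy \<open>R\<^sub>k\<^sub>+\<^sub>1 = R\<^sub>k + c\<^sub>k\<^sub>+\<^sub>1 x R\<^sub>k\<^sub>+\<^sub>2\<close>, then the continued fraction equals \<open>R\<^sub>1\<close>.
  At \<open>t = -1/q\<close> we have \<open>(1 - q)\<^sup>2 c\<^sub>m = (1 - q\<^sup>m) (1 + q\<^sup>m\<^sup>-\<^sup>1)\<close>, the recurrence coefficients of the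
  orthogonal polynomials \<open>P\<^sub>k\<close> (Al-Salam--Chihara with parameters \<open>1, -1\<close>). The coefficient of \<open>x\<^sup>p\<close>
  in \<open>(1 - q)\<^sup>2\<^sup>p R\<^sub>k\<^sub>+\<^sub>1\<close> is the coefficient of \<open>P\<^sub>k\<close> in the monomial \<open>y\<^sup>k\<^sup>+\<^sup>2\<^sup>p\<close>. It is found by expanding
  the monomial in Chebyshev polynomials \<open>U\<^sub>j\<close>, with ballot numbers as coefficients, and \<open>U\<^sub>j\<close> in the
  \<open>P\<^sub>k\<close>. The second expansion is a partial sum of that of \<open>U\<^sub>j - U\<^sub>j\<^sub>-\<^sub>2\<close>, whose coefficients are
  explicit in Gaussian binomials in \<open>q\<^sup>2\<close>.
\<close>

section \<open>Evaluating a continued fraction by a three-term recurrence\<close>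

lemma fps_X_dvd_if_nth_0:
  fixes f :: "'a::comm_ring_1 fps"
  assumes "fps_nth f 0 = 0"
  shows "fps_X dvd f"
proof
  show "f = fps_X * fps_shift 1 f"
    by (rule fps_ext) (use assms in \<open>simp add: fps_X_mult_nth\<close>)
qed

text \<open>The quotients Q_k = R_k / R_{k+1} satisfy Q_k = 1 - c_{k+1} x / Q_{k+1}, the recursion
  of the tails of the continued fraction; each level gains a factor x.\<close>

lemma cf_denom_ratio_dvd:
  fixes R :: "nat \<Rightarrow> 'a::field fps"
  assumes one: "\<And>k. fps_nth (R k) 0 = 1"
    and rec: "\<And>k. R (Suc k) = R k + fps_const (c (Suc k)) * fps_X * R (Suc (Suc k))"
  shows "fps_X ^ Suc N dvd cf_denom c (Suc k) N - R k * inverse (R (Suc k))"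
proof (induction N arbitrary: k)
  case 0
  have "fps_nth (1 - R k * inverse (R (Suc k))) 0 = 0"
    by (simp add: one)
  from fps_X_dvd_if_nth_0[OF this] show ?case by simp
next
  case (Suc N)
  let ?Q = "\<lambda>k. R k * inverse (R (Suc k))"
  have inv: "R j * inverse (R j) = 1" for j
    using one by (simp add: inverse_mult_eq_1')
  have "R k = R (Suc k) - fps_const (c (Suc k)) * fps_X * R (Suc (Suc k))"
    using rec[of k] by simp
  then have "?Q k = R (Suc k) * inverse (R (Suc k))
      - fps_const (c (Suc k)) * fps_X * (R (Suc (Suc k)) * inverse (R (Suc k)))"
    by (metis left_diff_distrib mult.assoc)
  moreover have "inverse (?Q (Suc k)) = R (Suc (Suc k)) * inverse (R (Suc k))"
    using one by (simp add: fps_inverse_mult fps_inverse_idempotent mult.commute)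
  ultimately have Q: "?Q k = 1 - fps_const (c (Suc k)) * fps_X * inverse (?Q (Suc k))"
    by (simp add: inv)
  have "fps_X ^ Suc N dvd inverse (cf_denom c (Suc (Suc k)) N) - inverse (?Q (Suc k))"
    by (rule fps_inverse_diff_dvd) (use Suc.IH[of "Suc k"] one in auto)
  then have "fps_X * fps_X ^ Suc N dvd
      fps_X * (inverse (cf_denom c (Suc (Suc k)) N) - inverse (?Q (Suc k)))"
    by (rule mult_dvd_mono[OF dvd_refl])
  then have "fps_X ^ Suc (Suc N) dvd - fps_const (c (Suc k)) *
      (fps_X * (inverse (cf_denom c (Suc (Suc k)) N) - inverse (?Q (Suc k))))"
    by (simp add: dvd_mult)
  also have "\<dots> = cf_denom c (Suc k) (Suc N) - ?Q k"
    by (subst Q) (simp add: fps_divide_unit algebra_simps flip: fps_const_neg)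
  finally show ?case .
qed

lemma continued_fraction_fps_eqI:
  fixes R :: "nat \<Rightarrow> 'a::field fps"
  assumes "R 0 = 1" and one: "\<And>k. fps_nth (R k) 0 = 1"
    and rec: "\<And>k. R (Suc k) = R k + fps_const (c (Suc k)) * fps_X * R (Suc (Suc k))"
  shows "continued_fraction_fps c = R 1"
proof (rule fps_ext)
  fix n
  have "fps_X ^ Suc n dvd cf_denom c (Suc 0) n - inverse (R 1)"
    using cf_denom_ratio_dvd[where R = R and c = c and N = n and k = 0, OF one rec] assms(1) by simp
  then have "fps_X ^ Suc n dvd inverse (cf_denom c 1 n) - inverse (inverse (R 1))"
    by (intro fps_inverse_diff_dvd) (use one in auto)
  then have "fps_X ^ Suc n dvd inverse (cf_denom c 1 n) - R 1"
    using one by (simp add: fps_inverse_idempotent)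
  then obtain g where "inverse (cf_denom c 1 n) - R 1 = fps_X ^ Suc n * g" ..
  then have "fps_nth (inverse (cf_denom c 1 n) - R 1) n = 0"
    by (simp only: fps_X_power_mult_nth) simp
  then show "fps_nth (continued_fraction_fps c) n = fps_nth (R 1) n"
    by (simp add: continued_fraction_fps_nth[of n n] fps_divide_unit)
qed

section \<open>Gaussian binomials\<close>

text \<open>\<open>gauss Q k m\<close> is the Gaussian binomial of \<open>k + m\<close> over \<open>m\<close>. It is defined by Pascal's rule
  because quotients of \<open>Q\<close>-factorials make no sense at roots of unity.\<close>

fun gauss :: "'a::comm_ring_1 \<Rightarrow> nat \<Rightarrow> nat \<Rightarrow> 'a" where
  "gauss Q 0 m = 1"
| "gauss Q (Suc k) 0 = 1"
| "gauss Q (Suc k) (Suc m) = gauss Q k (Suc m) + Q ^ Suc k * gauss Q (Suc k) m"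

lemma gauss_0_right [simp]: "gauss Q k 0 = 1"
  by (cases k) auto

text \<open>The assumption is \<open>gauss_Suc_right\<close> for this k; the induction step there,
  from k to k + 1, needs the conclusion.\<close>

lemma gauss_Suc_left_if:
  assumes "\<And>m. (1 - Q ^ Suc m) * gauss Q k (Suc m) = (1 - Q ^ Suc (k + m)) * gauss Q k m"
  shows "(1 - Q ^ Suc k) * gauss Q (Suc k) m = (1 - Q ^ Suc (k + m)) * gauss Q k m"
proof (induction m)
  case (Suc m)
  have "(1 - Q ^ Suc k) * gauss Q (Suc k) (Suc m) =
      (1 - Q ^ Suc k) * gauss Q k (Suc m) + Q ^ Suc k * ((1 - Q ^ Suc k) * gauss Q (Suc k) m)"
    by (simp add: algebra_simps)
  also have "\<dots> = (1 - Q ^ Suc k) * gauss Q k (Suc m) + Q ^ Suc k * ((1 - Q ^ Suc m) * gauss Q k (Suc m))"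
    by (simp only: Suc.IH assms)
  also have "\<dots> = (1 - Q ^ Suc (k + Suc m)) * gauss Q k (Suc m)"
    by (simp add: algebra_simps power_add)
  finally show ?case .
qed simp

lemma gauss_Suc_right:
  "(1 - Q ^ Suc m) * gauss Q k (Suc m) = (1 - Q ^ Suc (k + m)) * gauss Q k m"
proof (induction k arbitrary: m)
  case (Suc k)
  have "(1 - Q ^ Suc m) * gauss Q (Suc k) (Suc m) =
      (1 - Q ^ Suc m) * gauss Q k (Suc m) + Q ^ Suc k * (1 - Q ^ Suc m) * gauss Q (Suc k) m"
    by (simp add: algebra_simps)
  also have "\<dots> = (1 - Q ^ Suc k) * gauss Q (Suc k) m + Q ^ Suc k * (1 - Q ^ Suc m) * gauss Q (Suc k) m"
    by (simp only: Suc.IH gauss_Suc_left_if[OF Suc.IH])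
  also have "\<dots> = (1 - Q ^ Suc (Suc k + m)) * gauss Q (Suc k) m"
    by (simp add: algebra_simps power_add)
  finally show ?case .
qed simp

lemmas gauss_Suc_left = gauss_Suc_left_if[OF gauss_Suc_right]

lemma gauss_Suc_Suc':
  "gauss Q (Suc k) (Suc m) = gauss Q (Suc k) m + Q ^ Suc m * gauss Q k (Suc m)"
proof -
  have "(1 - Q ^ Suc m) * gauss Q k (Suc m) = (1 - Q ^ Suc k) * gauss Q (Suc k) m"
    by (simp only: gauss_Suc_left gauss_Suc_right)
  then show ?thesis
    by (simp add: algebra_simps)
qed

section \<open>Chebyshev polynomials in the basis of the orthogonal polynomials\<close>

text \<open>This is (1 - q)^2 c_{k+1}; the shift avoids the exponent m - 1.\<close>

definition lam :: "'a::comm_ring_1 \<Rightarrow> nat \<Rightarrow> 'a" where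
  "lam q k = (1 - q ^ Suc k) * (1 + q ^ k)"

fun cheb_abs :: "'a::comm_ring_1 \<Rightarrow> nat \<Rightarrow> nat \<Rightarrow> 'a" where
  "cheb_abs q k 0 = 1"
| "cheb_abs q k (Suc m) = gauss (q\<^sup>2) k (Suc m) + q ^ k * gauss (q\<^sup>2) k m"

text \<open>The coefficient of \<open>P\<^sub>k\<close> in \<open>U\<^sub>j - U\<^sub>j\<^sub>-\<^sub>2\<close>, and then in \<open>U\<^sub>j\<close>, for \<open>j = k + 2 m\<close>.\<close>

definition cheb_T :: "'a::comm_ring_1 \<Rightarrow> nat \<Rightarrow> nat \<Rightarrow> 'a" where
  "cheb_T q k m = (- 1) ^ m * q ^ m\<^sup>2 * cheb_abs q k m"

definition cheb_U :: "'a::comm_ring_1 \<Rightarrow> nat \<Rightarrow> nat \<Rightarrow> 'a" where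
  "cheb_U q k m = (\<Sum>i\<le>m. cheb_T q k i)"

lemma cheb_U_0 [simp]: "cheb_U q k 0 = 1"
  by (simp add: cheb_U_def cheb_T_def)

lemma cheb_U_Suc: "cheb_U q k (Suc m) = cheb_U q k m + cheb_T q k (Suc m)"
  by (simp add: cheb_U_def)

text \<open>The factor, which \<open>lam q k\<close> supplies, merges the two Gaussian binomials
  into one.\<close>

lemma cheb_abs_Suc_left:
  "(1 - q ^ Suc k) * cheb_abs q (Suc k) m = (1 - q ^ (Suc k + 2 * m)) * gauss (q\<^sup>2) k m"
proof (cases m)
  case 0
  then show ?thesis by simp
next
  case (Suc n)
  define y where "y = q ^ Suc k"
  define Q where "Q = q\<^sup>2"
  have yy: "Q ^ Suc k = y * y"
    by (simp add: Q_def y_def power_mult_distrib power2_eq_square)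
  have QQ: "q ^ (Suc k + 2 * Suc n) = y * Q ^ Suc n"
    unfolding Q_def y_def power_mult[symmetric] power_add[symmetric] by simp
  have g: "(1 - y * y) * gauss Q (Suc k) n = (1 - Q ^ Suc n) * gauss Q k (Suc n)"
    using gauss_Suc_left[of Q k n] gauss_Suc_right[of Q n k] unfolding yy by simp
  have "cheb_abs q (Suc k) m = gauss Q k (Suc n) + y * y * gauss Q (Suc k) n + y * gauss Q (Suc k) n"
    unfolding Suc cheb_abs.simps gauss.simps Q_def[symmetric] y_def[symmetric] yy ..
  then have "(1 - y) * cheb_abs q (Suc k) m =
      (1 - y) * gauss Q k (Suc n) + y * ((1 - y * y) * gauss Q (Suc k) n)"
    by (simp add: algebra_simps)
  also have "\<dots> = (1 - y * Q ^ Suc n) * gauss Q k (Suc n)"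
    unfolding g by (simp add: algebra_simps)
  finally show ?thesis
    unfolding Suc QQ y_def Q_def .
qed

lemma cheb_abs_rec:
  "q ^ Suc (2 * m) * (cheb_abs q (Suc k) (Suc m) - cheb_abs q k (Suc m)) =
    cheb_abs q (Suc k) m - lam q (Suc k) * cheb_abs q (Suc (Suc k)) m"
proof -
  define y where "y = q ^ Suc k"
  define Q where "Q = q\<^sup>2"
  define z where "z = Q ^ m"
  have y: "q * q ^ k = y" by (simp add: y_def)
  have yy: "Q ^ Suc k = y * y"
    by (simp add: Q_def y_def power_mult_distrib power2_eq_square)
  have qz: "q ^ Suc (2 * m) = q * z" by (simp add: z_def Q_def power_mult)
  have qyz: "q ^ (Suc (Suc k) + 2 * m) = q * y * z"
    unfolding y_def z_def Q_def power_mult[symmetric] power_add[symmetric] by (simp add: power_add)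
  have "lam q (Suc k) * cheb_abs q (Suc (Suc k)) m =
      (1 + y) * ((1 - q ^ Suc (Suc k)) * cheb_abs q (Suc (Suc k)) m)"
    unfolding lam_def y_def by (simp only: ac_simps)
  then have lam: "lam q (Suc k) * cheb_abs q (Suc (Suc k)) m = (1 + y) * (1 - q * y * z) * gauss Q (Suc k) m"
    unfolding cheb_abs_Suc_left qyz Q_def by (simp only: mult.assoc)
  have lhs: "q ^ Suc (2 * m) * (cheb_abs q (Suc k) (Suc m) - cheb_abs q k (Suc m)) =
      q * z * (y * y * gauss Q (Suc k) m + y * gauss Q (Suc k) m) - z * (y * gauss Q k m)"
    unfolding qz cheb_abs.simps gauss.simps Q_def[symmetric] y_def[symmetric] yy
    unfolding y[symmetric] by (simp add: algebra_simps)
  show ?thesis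
  proof (cases m)
    case 0
    then show ?thesis unfolding lhs lam by (simp add: z_def algebra_simps)
  next
    case (Suc n)
    have "cheb_abs q (Suc k) m = gauss Q (Suc k) m + y * gauss Q (Suc k) n"
      unfolding Suc cheb_abs.simps y_def Q_def ..
    moreover have "gauss Q (Suc k) n = gauss Q (Suc k) m - z * gauss Q k m"
      using gauss_Suc_Suc'[of Q k n] unfolding Suc z_def by simp
    ultimately show ?thesis
      unfolding lhs lam by (simp add: algebra_simps)
  qed
qed

lemma power_Suc_square:
  fixes q :: "'a::comm_ring_1"
  shows "q ^ (Suc m)\<^sup>2 = q ^ m\<^sup>2 * q ^ Suc (2 * m)"
proof -
  have "(Suc m)\<^sup>2 = m\<^sup>2 + Suc (2 * m)"
    by (simp add: power2_eq_square)
  then show ?thesis by (simp only: power_add)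
qed

text \<open>With V_j = U_j - U_{j-2} and j = k + 2m + 2, these are the coefficients of P_{k+1} in
  V_{j+1} + V_{j-1} = y V_j, where y P_i = P_{i+1} + (1 - q)^2 c_i P_{i-1}.\<close>

lemma cheb_T_rec:
  "cheb_T q (Suc k) (Suc m) + cheb_T q (Suc k) m =
    cheb_T q k (Suc m) + lam q (Suc k) * cheb_T q (Suc (Suc k)) m"
proof -
  have "cheb_T q (Suc k) (Suc m) - cheb_T q k (Suc m) = - ((- 1) ^ m * q ^ m\<^sup>2 *
      (q ^ Suc (2 * m) * (cheb_abs q (Suc k) (Suc m) - cheb_abs q k (Suc m))))"
    by (simp add: cheb_T_def power_Suc_square algebra_simps del: cheb_abs.simps)
  then show ?thesis
    unfolding cheb_abs_rec by (simp add: cheb_T_def algebra_simps)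
qed

lemma cheb_U_rec:
  "cheb_U q (Suc k) (Suc m) + cheb_U q (Suc k) m =
    cheb_U q k (Suc m) + lam q (Suc k) * cheb_U q (Suc (Suc k)) m"
proof (induction m)
  case 0
  show ?case using cheb_T_rec[of q k 0] by (simp add: cheb_U_Suc) (simp add: cheb_T_def)
next
  case (Suc m)
  then show ?case
    using cheb_T_rec[of q k "Suc m"] unfolding cheb_U_Suc[of _ _ "Suc m"] cheb_U_Suc[of _ "Suc (Suc k)" m]
    by (simp add: algebra_simps cheb_U_Suc)
qed

text \<open>For k = 0 both Gaussian binomials are 1; the 2 will count the indices m + 1 and -(m + 1)
  of the theta sum.\<close>

lemma cheb_T_0_Suc: "cheb_T q 0 (Suc m) = 2 * (- q) ^ (Suc m)\<^sup>2"
proof -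
  have "(- 1 :: 'a) ^ (Suc m)\<^sup>2 = (- 1) ^ Suc m"
    by (cases "even m") auto
  then show ?thesis
    by (simp add: cheb_T_def power_minus[of q] del: power_Suc)
qed

text \<open>The coefficient of P_0 in y U_j, j = 2m + 1. The analogue for \<open>cheb_T\<close>
  fails at m = 0, since \<open>cheb_T q 0 0\<close> is 1 and not 2, so the base case is computed
  directly.\<close>

lemma cheb_U_rec_0: "cheb_U q 0 (Suc m) + cheb_U q 0 m = lam q 0 * cheb_U q (Suc 0) m"
proof (induction m)
  case 0
  show ?case by (simp add: cheb_U_Suc cheb_T_0_Suc lam_def algebra_simps)
next
  case (Suc m)
  have "cheb_T q 0 (Suc (Suc m)) + cheb_T q 0 (Suc m) =
      (- 1) ^ Suc m * q ^ (Suc m)\<^sup>2 * (2 * (1 - q ^ (Suc 0 + 2 * Suc m)))"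
    by (simp add: cheb_T_def power_Suc_square[of q "Suc m"] algebra_simps)
  also have "\<dots> = lam q 0 * cheb_T q (Suc 0) (Suc m)"
  proof -
    have "1 - q ^ (Suc 0 + 2 * Suc m) = (1 - q) * cheb_abs q (Suc 0) (Suc m)"
      using cheb_abs_Suc_left[of q 0 "Suc m"] by simp
    then show ?thesis
      by (simp only:) (simp add: cheb_T_def lam_def algebra_simps del: cheb_abs.simps)
  qed
  finally show ?case
    using Suc.IH by (simp add: cheb_U_Suc algebra_simps)
qed

lemma cheb_U_0_eq:
  fixes q :: "'a::field"
  shows "cheb_U q 0 m = (\<Sum>i\<in>{- int m..int m}. (- q) powi (i\<^sup>2))"
proof (induction m)
  case (Suc m)
  have set: "{- int (Suc m)..int (Suc m)} = insert (int (Suc m)) (insert (- int (Suc m)) {- int m..int m})"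
    by auto
  have pow: "(- q) powi ((int (Suc m))\<^sup>2) = (- q) ^ (Suc m)\<^sup>2"
    unfolding of_nat_power[symmetric] power_int_of_nat ..
  show ?case
    unfolding set cheb_U_Suc Suc.IH cheb_T_0_Suc
    by (subst sum.insert, simp, simp, subst sum.insert) (simp_all add: pow del: of_nat_Suc)
qed simp

section \<open>Ballot numbers and the resulting power series\<close>

text \<open>For 2r \<le> n, the coefficient of U_{n-2r} in y^n.\<close>

fun ballot :: "nat \<Rightarrow> nat \<Rightarrow> 'a::comm_ring_1" where
  "ballot n 0 = 1"
| "ballot n (Suc r) = of_nat (n choose Suc r) - of_nat (n choose r)"

lemma ballot_Suc_Suc: "ballot (Suc n) (Suc r) = ballot n (Suc r) + ballot n r"
  by (cases r) (simp_all add: algebra_simps)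

text \<open>This reflects U_{-1} = 0.\<close>

lemma ballot_middle: "ballot (Suc (2 * r)) (Suc r) = 0"
  using binomial_symmetric[of r "Suc (2 * r)"] by (simp add: mult_2)

text \<open>The coefficient of \<open>P\<^sub>k\<close> in \<open>y\<^sup>k\<^sup>+\<^sup>2\<^sup>p\<close>.\<close>

definition path_weight :: "'a::comm_ring_1 \<Rightarrow> nat \<Rightarrow> nat \<Rightarrow> 'a" where
  "path_weight q k p = (\<Sum>m\<le>p. ballot (k + 2 * p) (p - m) * cheb_U q k m)"

lemma path_weight_0 [simp]: "path_weight q k 0 = 1"
  by (simp add: path_weight_def)

text \<open>Expands y^{n+1} as y times y^n, pairing U_{j+1} with U_{j-1} so that
  \<open>cheb_U_rec\<close> or \<open>cheb_U_rec_0\<close> applies.\<close>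

lemma path_weight_split:
  assumes "Suc n = k + 2 * Suc p"
  shows "path_weight q k (Suc p) = ballot n (Suc p) +
    (\<Sum>m\<le>p. ballot n (p - m) * (cheb_U q k (Suc m) + cheb_U q k m))"
proof -
  have "path_weight q k (Suc p) =
      (\<Sum>m\<le>p. ballot (Suc n) (Suc (p - m)) * cheb_U q k m) + cheb_U q k (Suc p)"
    unfolding path_weight_def assms[symmetric] by (simp add: Suc_diff_le)
  also have "\<dots> = (\<Sum>m\<le>p. ballot n (Suc p - m) * cheb_U q k m) + ballot n 0 * cheb_U q k (Suc p)
      + (\<Sum>m\<le>p. ballot n (p - m) * cheb_U q k m)"
    by (simp add: ballot_Suc_Suc Suc_diff_le algebra_simps sum.distrib del: ballot.simps(2))
  also have "(\<Sum>m\<le>p. ballot n (Suc p - m) * cheb_U q k m) + ballot n 0 * cheb_U q k (Suc p) =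
      (\<Sum>m\<le>Suc p. ballot n (Suc p - m) * cheb_U q k m)"
    by simp
  also have "\<dots> = ballot n (Suc p) + (\<Sum>m\<le>p. ballot n (p - m) * cheb_U q k (Suc m))"
    by (subst sum.atMost_Suc_shift) simp
  finally show ?thesis
    by (simp add: algebra_simps sum.distrib del: ballot.simps(2))
qed

lemma path_weight_rec:
  "path_weight q (Suc k) (Suc p) =
    path_weight q k (Suc p) + lam q (Suc k) * path_weight q (Suc (Suc k)) p"
proof -
  let ?n = "k + 2 * Suc p"
  have "path_weight q (Suc k) (Suc p) = ballot ?n (Suc p) +
      (\<Sum>m\<le>p. ballot ?n (p - m) * cheb_U q k (Suc m)) +
      lam q (Suc k) * (\<Sum>m\<le>p. ballot ?n (p - m) * cheb_U q (Suc (Suc k)) m)"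
    by (subst path_weight_split[of ?n])
       (simp_all add: cheb_U_rec distrib_left sum.distrib sum_distrib_left mult.left_commute
         del: ballot.simps(2))
  \<comment> \<open>The unpaired ballot number is the summand m = 0 here.\<close>
  moreover have "path_weight q k (Suc p) =
      ballot ?n (Suc p) + (\<Sum>m\<le>p. ballot ?n (p - m) * cheb_U q k (Suc m))"
    unfolding path_weight_def by (subst sum.atMost_Suc_shift) simp
  ultimately show ?thesis
    by (simp add: path_weight_def)
qed

lemma path_weight_rec_0: "path_weight q 0 (Suc p) = lam q 0 * path_weight q (Suc 0) p"
  by (subst path_weight_split[of "Suc (2 * p)"])
     (simp_all add: ballot_middle cheb_U_rec_0 path_weight_def sum_distrib_left mult.left_commute
       del: ballot.simps(2))

lemma tq_Euler_eq_path_weight: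
  fixes q :: "'a::field"
  assumes "q \<noteq> 0"
  shows "tq_Euler n (- 1 / q) q = path_weight q 0 n / (1 - q) ^ (2 * n)"
proof -
  define s where "s = (1 - q)\<^sup>2"
  define c where "c = (\<lambda>m. q_bracket q m * tq_bracket (- 1 / q) q m)"
  define R where "R = (\<lambda>k. case k of 0 \<Rightarrow> 1 | Suc j \<Rightarrow> Abs_fps (\<lambda>p. path_weight q j p / s ^ p))"
  have c: "c (Suc k) = lam q k / s" for k
    using assms by (simp add: c_def q_bracket_def tq_bracket_def lam_def s_def power2_eq_square)
  have "continued_fraction_fps c = R 1"
  proof (rule continued_fraction_fps_eqI)
    show "R 0 = 1" by (simp add: R_def)
    show "fps_nth (R k) 0 = 1" for k by (cases k) (simp_all add: R_def)
    show "R (Suc k) = R k + fps_const (c (Suc k)) * fps_X * R (Suc (Suc k))" for k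
    proof (rule fps_ext)
      fix p
      show "fps_nth (R (Suc k)) p = fps_nth (R k + fps_const (c (Suc k)) * fps_X * R (Suc (Suc k))) p"
        \<comment> \<open>p = 0 compares constant terms; for k = 0 and p > 0, \<open>R 0 = 1\<close>
          contributes nothing, which matches \<open>path_weight_rec_0\<close>.\<close>
        by (cases p; cases k)
           (simp_all add: R_def c mult.assoc path_weight_rec path_weight_rec_0 add_divide_distrib)
    qed
  qed
  then show ?thesis
    unfolding tq_Euler_def c_def[symmetric] by (simp add: R_def s_def power_mult)
qed

theorem proposition5p16:
  fixes q :: "'a::field" and n :: nat
  assumes "q \<noteq> 0" and "q \<noteq> 1"
  shows "tq_Euler n (- 1 / q) q =
    1 / (1 - q) ^ (2 * n) *
      (\<Sum>k=0..n.
        (of_nat (binom (2 * n) (int n - int k)) - of_nat (binom (2 * n) (int n - int k - 1))) *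
        (\<Sum>i\<in>{- int k..int k}. (- q) powi (i\<^sup>2)))"
proof -
  have "of_nat (binom (2 * n) (int n - int k)) - of_nat (binom (2 * n) (int n - int k - 1)) =
      (ballot (2 * n) (n - k) :: 'a)" if "k \<le> n" for k
  proof (cases "n - k")
    case 0
    then show ?thesis using that by (simp add: binom_def)
  next
    case (Suc r)
    then have "int n - int k = int (Suc r)" using that by linarith
    then show ?thesis unfolding Suc by (simp add: binom_def nat_add_distrib)
  qed
  then show ?thesis
    unfolding tq_Euler_eq_path_weight[OF assms(1)] path_weight_def cheb_U_0_eq[symmetric]
    by (simp add: atLeast0AtMost)
qed

end
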